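(* For $n\ge1$ let \[ P_{n}(y,z,s,t)=P_{n}^{(\mathrm{lpk},\mathrm{ipk},\mathrm{des},\mathrm{ides})}(y,z,s,t)=\sum_{\pi\in\mathfrak{S}_{n}}y^{\mathrm{lpk}(\pi)}z^{\mathrm{ipk}(\pi)+1}s^{\mathrm{des}(\pi)}t^{\mathrm{ides}(\pi)+1}. \] Then, as formal power series, \begin{multline*} \frac{1}{(1-s)(1-t)}+\sum_{n=1}^{\infty}\frac{(1+ys)^{n}(1+zt)^{n+1}P_{n}\left(\frac{(1+y)^{2}s}{(y+s)(1+ys)},\frac{(1+z)^{2}t}{(z+t)(1+zt)},\frac{y+s}{1+ys},\frac{z+t}{1+zt}\right)}{(1+z)(1-s)^{n+1}(1-t)^{n+1}}x^{n}\\ =\sum_{i,j=0}^{\infty}\left(\frac{1+yx}{1-yzx}\right)^{ij}\left(\frac{1+zx}{1-x}\right)^{(i+1)j}s^{i}t^{j}. \end{multline*}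
   Context: $\mathfrak{S}_n$ is the symmetric group on $[n]$. For $\pi\in\mathfrak{S}_n$: $i\in[n-1]$ is a descent if $\pi(i)>\pi(i+1)$ and $\mathrm{des}(\pi)$ is the number of descents; $i$ with $2\le i\le n-1$ is a peak if $\pi(i-1)<\pi(i)>\pi(i+1)$ and $\mathrm{pk}(\pi)$ is the number of peaks; $i\in[n-1]$ is a left peak if $i$ is a peak, or if $i=1$ and $\pi(1)>\pi(2)$, and $\mathrm{lpk}(\pi)$ is the number of left peaks. Inverse statistics: $\mathrm{ides}(\pi)=\mathrm{des}(\pi^{-1})$, $\mathrm{ipk}(\pi)=\mathrm{pk}(\pi^{-1})$. *)

theory Defs
  imports
    "HOL-Computational_Algebra.Formal_Power_Series"
    "HOL-Computational_Algebra.Fraction_Field"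
    "HOL-Computational_Algebra.Polynomial"
    "HOL-Combinatorics.Permutations"
begin

unbundle fps_syntax

text \<open>A permutation in the symmetric group on \<open>{1..n}\<close> is a function \<open>\<pi>\<close> with
  \<^term>\<open>\<pi> permutes {1..n}\<close>; the size \<open>n\<close> is passed to the statistics explicitly.\<close>

definition des :: "nat \<Rightarrow> (nat \<Rightarrow> nat) \<Rightarrow> nat" where
  "des n \<pi> = card {i \<in> {1..n - 1}. \<pi> i > \<pi> (i + 1)}"

definition is_peak :: "nat \<Rightarrow> (nat \<Rightarrow> nat) \<Rightarrow> nat \<Rightarrow> bool" where
  "is_peak n \<pi> i \<longleftrightarrow> i \<in> {2..n - 1} \<and> \<pi> (i - 1) < \<pi> i \<and> \<pi> i > \<pi> (i + 1)"

definition pk :: "nat \<Rightarrow> (nat \<Rightarrow> nat) \<Rightarrow> nat" where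
  "pk n \<pi> = card {i. is_peak n \<pi> i}"

definition lpk :: "nat \<Rightarrow> (nat \<Rightarrow> nat) \<Rightarrow> nat" where
  "lpk n \<pi> = card {i \<in> {1..n - 1}. is_peak n \<pi> i \<or> (i = 1 \<and> \<pi> 1 > \<pi> 2)}"

definition ides :: "nat \<Rightarrow> (nat \<Rightarrow> nat) \<Rightarrow> nat" where
  "ides n \<pi> = des n (inv \<pi>)"

definition ipk :: "nat \<Rightarrow> (nat \<Rightarrow> nat) \<Rightarrow> nat" where
  "ipk n \<pi> = pk n (inv \<pi>)"

definition P :: "nat \<Rightarrow> 'a \<Rightarrow> 'a \<Rightarrow> 'a \<Rightarrow> 'a \<Rightarrow> 'a::comm_semiring_1" where
  "P n y z s t = (\<Sum>\<pi> | \<pi> permutes {1..n}.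
     y ^ lpk n \<pi> * z ^ (ipk n \<pi> + 1) * s ^ des n \<pi> * t ^ (ides n \<pi> + 1))"

text \<open>The identity lives in the ring \<open>\<rat>(y,z)[[t]][[s]][[x]]\<close>, where
  \<open>\<rat>(y,z)\<close> is the fraction field of \<open>\<rat>[y][z]\<close>. All denominators of the identity are units
  there (lemma \<open>denominators_are_units\<close>), so division has its usual meaning; in
  \<open>\<rat>[[x,y,z,s,t]]\<close> this would fail for \<open>y + s\<close> and \<open>z + t\<close>.\<close>

type_synonym ratfun = "rat poly poly fract"
type_synonym series = "ratfun fps fps fps"

definition var_x :: series where
  "var_x = fps_X"

definition var_s :: series where
  "var_s = fps_const fps_X"

definition var_t :: series where
  "var_t = fps_const (fps_const fps_X)"

definition var_y :: series where
  "var_y = fps_const (fps_const (fps_const (Fract [:[:0, 1:]:] 1)))"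

definition var_z :: series where
  "var_z = fps_const (fps_const (fps_const (Fract [:0, 1:] 1)))"

text \<open>Infinite sums are taken coefficientwise in the monomials \<open>x\<^sup>n s\<^sup>i t\<^sup>j\<close>.
  The library's metric on \<^typ>\<open>'a fps\<close> only sees the outermost variable, so its
  \<^const>\<open>suminf\<close> would not do for sums over powers of \<open>s\<close> and \<open>t\<close>.\<close>

definition formally_summable :: "('i \<Rightarrow> series) \<Rightarrow> 'i set \<Rightarrow> bool" where
  "formally_summable F I \<longleftrightarrow> (\<forall>n i j. finite {k \<in> I. F k $ n $ i $ j \<noteq> 0})"

definition formal_sum :: "('i \<Rightarrow> series) \<Rightarrow> 'i set \<Rightarrow> series" where
  "formal_sum F I = Abs_fps (\<lambda>n. Abs_fps (\<lambda>i. Abs_fps (\<lambda>j.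
     \<Sum>k | k \<in> I \<and> F k $ n $ i $ j \<noteq> 0. F k $ n $ i $ j)))"

lemma formally_summable_x: "formally_summable (\<lambda>n. a n * var_x ^ n) I"
  unfolding formally_summable_def
proof (intro allI)
  fix n i j
  have "{k \<in> I. (a k * var_x ^ k) $ n $ i $ j \<noteq> 0} \<subseteq> {..n}"
    by (auto simp: var_x_def fps_X_power_mult_right_nth intro: leI)
  then show "finite {k \<in> I. (a k * var_x ^ k) $ n $ i $ j \<noteq> 0}"
    by (rule finite_subset) simp
qed

lemma formally_summable_st:
  "formally_summable (\<lambda>(i, j). a i j * var_s ^ i * var_t ^ j) I"
  unfolding formally_summable_def
proof (intro allI)
  fix n i j
  have s: "var_s ^ k = fps_const (fps_X ^ k)"
    and t: "var_t ^ k = fps_const (fps_const (fps_X ^ k))" for k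
    by (simp_all add: var_s_def var_t_def)
  have "(a k l * var_s ^ k * var_t ^ l) $ n $ i $ j =
      (if k \<le> i \<and> l \<le> j then a k l $ n $ (i - k) $ (j - l) else 0)" for k l
    unfolding s t
    by (simp add: fps_X_power_mult_right_nth)
  then have "{kl \<in> I. (case kl of (k, l) \<Rightarrow> a k l * var_s ^ k * var_t ^ l) $ n $ i $ j \<noteq> 0}
      \<subseteq> {..i} \<times> {..j}"
    by (auto split: if_splits)
  then show "finite {kl \<in> I. (case kl of (k, l) \<Rightarrow> a k l * var_s ^ k * var_t ^ l) $ n $ i $ j \<noteq> 0}"
    by (rule finite_subset) simp
qed

lemma fps_dvd_1I:
  fixes f :: "'a::comm_ring_1 fps"
  assumes "f $ 0 dvd 1"
  shows "f dvd 1"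
proof -
  obtain c where "1 = f $ 0 * c" using assms by (elim dvdE)
  then have "f * fps_right_inverse f c = 1"
    by (intro fps_right_inverse) simp_all
  then show ?thesis by (metis dvd_triv_left)
qed

lemma denominators_are_units:
  "var_y + var_s dvd 1" "1 + var_y * var_s dvd 1"
  "var_z + var_t dvd 1" "1 + var_z * var_t dvd 1"
  "1 + var_z dvd 1" "1 - var_s dvd 1" "1 - var_t dvd 1" "1 - var_x dvd 1"
  "1 - var_y * var_z * var_x dvd 1"
proof -
  have nz: "Fract p 1 \<noteq> (0 :: ratfun)" if "p \<noteq> 0" for p
    using that by (simp add: Zero_fract_def eq_fract)
  have "1 + Fract [:0, 1:] 1 = (Fract [:1, 1:] 1 :: ratfun)"
    unfolding One_fract_def by (subst add_fract) (simp_all add: one_pCons)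
  then have "Fract [:[:0, 1:]:] 1 \<noteq> (0 :: ratfun)" "Fract [:0, 1:] 1 \<noteq> (0 :: ratfun)"
    "1 + Fract [:0, 1:] 1 \<noteq> (0 :: ratfun)"
    using nz by auto
  then show "var_y + var_s dvd 1" "1 + var_y * var_s dvd 1"
    "var_z + var_t dvd 1" "1 + var_z * var_t dvd 1"
    "1 + var_z dvd 1" "1 - var_s dvd 1" "1 - var_t dvd 1" "1 - var_x dvd 1"
    "1 - var_y * var_z * var_x dvd 1"
    by (intro fps_dvd_1I; simp add: var_x_def var_y_def var_z_def var_s_def var_t_def dvd_field_iff)+
qed

lemma fps_nth_0_dvd_1:
  fixes f :: "'a::comm_ring_1 fps"
  assumes "f dvd 1"
  shows "f $ 0 dvd 1"
proof -
  obtain g where "1 = f * g" using assms by (elim dvdE)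
  then have "1 = f $ 0 * g $ 0" by (metis fps_mult_nth_0 fps_one_nth)
  then show ?thesis by (rule dvdI)
qed

lemma fps_inverse_right:
  fixes f :: "'a::{comm_ring_1, inverse} fps"
  assumes "f $ 0 * inverse (f $ 0) = 1"
  shows "f * inverse f = 1"
  unfolding fps_inverse_def using fps_right_inverse[OF assms] by simp

lemma divide_by_unit:
  fixes f d :: series
  assumes "d dvd 1"
  shows "f / d * d = f"
proof -
  have "d $ 0 $ 0 $ 0 dvd 1"
    by (intro fps_nth_0_dvd_1 assms)
  then have *: "d $ 0 \<noteq> 0" "d $ 0 $ 0 $ 0 \<noteq> 0" by auto
  then have "d * inverse d = 1"
    by (intro fps_inverse_right) simp
  moreover have "subdegree d = 0" "unit_factor d = d"
    using * by (simp_all add: subdegree_eq_0)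
  ultimately show ?thesis
    by (simp add: fps_divide_def mult.assoc mult.commute[of _ d])
qed

end

theory Submission
  imports Defs
begin

text \<open>
  Both sides count two-rowed arrays with signed letters. Expanding the right-hand side over pairs
  of letters (row letter, column letter), the factor of a pair is geometric if the signs agree
  and of the form \<open>1 + w x\<close> if they differ; so the coefficient of \<open>x\<^sup>n s\<^sup>i t\<^sup>j\<close> counts the
  chains of \<open>n\<close> pairs in a suitable total order in which exactly the pairs of agreeing sign
  may be repeated. Standardizing the word of column letters turns such a chain into a permutation
  \<open>\<pi>\<close>, an enriched \<open>\<pi>\<close>-partition and an enriched \<open>\<pi>\<inverse>\<close>-partition. The generating function of
  the enriched partitions of a fixed permutation is a transfer-matrix product in which every
  step contributes a matrix of rank one; hence it is a product of four kinds of factors, whose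
  exponents are determined by the numbers of descents and of (left) peaks.

  The letters are natural numbers: \<open>2 m\<close> and \<open>2 m - 1\<close> stand for the unsigned and the
  signed letter of level \<open>m\<close>, and \<open>0\<close> for the letter of level \<open>0\<close>, which exists only in
  the row alphabet (in the column alphabet it has weight \<open>0\<close>).
\<close>

section \<open>Weighted sums over chains\<close>

text \<open>Sums the weights of all words \<open>b\<^sub>1 \<dots> b\<^sub>n\<close> over \<open>A\<close> with \<open>R k b\<^sub>k b\<^sub>k\<^sub>+\<^sub>1\<close> for
  \<open>1 \<le> k \<le> n\<close>, where \<open>b\<^sub>n\<^sub>+\<^sub>1 = a\<close> is not counted; taking for \<open>a\<close> a sentinel above \<open>A\<close>
  gives the sum over all chains.\<close>

primrec chain_sum ::
  "(nat \<Rightarrow> 'l \<Rightarrow> 'l \<Rightarrow> bool) \<Rightarrow> 'l set \<Rightarrow> ('l \<Rightarrow> 'a) \<Rightarrow> nat \<Rightarrow> 'l \<Rightarrow> 'a::comm_semiring_1"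
where
  "chain_sum R A v 0 a = 1"
| "chain_sum R A v (Suc n) a =
     (\<Sum>b\<in>A. if R (Suc n) b a then v b * chain_sum R A v n b else 0)"

lemma chain_sum_cong:
  assumes "\<And>k b a. 1 \<le> k \<Longrightarrow> k \<le> n \<Longrightarrow> R k b a = R' k b a"
  shows "chain_sum R A v n a = chain_sum R' A v n a"
  using assms by (induction n arbitrary: a) (auto intro!: sum.cong)

lemma chain_sum_hom:
  assumes "\<phi> 0 = 0" "\<phi> 1 = 1"
    and "\<And>a b. \<phi> (a + b) = \<phi> a + \<phi> b" "\<And>a b. \<phi> (a * b) = \<phi> a * \<phi> b"
  shows "\<phi> (chain_sum R A v n a) = chain_sum R A (\<lambda>b. \<phi> (v b)) n a"
proof (induction n arbitrary: a)
  case (Suc n)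
  have sum: "\<phi> (sum f A) = (\<Sum>b\<in>A. \<phi> (f b))" for f
    by (induction A rule: infinite_finite_induct) (simp_all add: assms)
  show ?case
    by (simp add: sum Suc.IH[symmetric] assms if_distrib cong: if_cong)
qed (simp add: assms)

lemma sum_PiE_Suc:
  assumes "finite A"
  shows "(\<Sum>g\<in>{1..Suc n} \<rightarrow>\<^sub>E A. F g) = (\<Sum>b\<in>A. \<Sum>g\<in>{1..n} \<rightarrow>\<^sub>E A. F (g(Suc n := b)))"
proof -
  have *: "{1..Suc n} = insert (Suc n) {1..n}" by auto
  have "(\<Sum>g\<in>{1..Suc n} \<rightarrow>\<^sub>E A. F g) =
      (\<Sum>(b, g)\<in>A \<times> ({1..n} \<rightarrow>\<^sub>E A). F (g(Suc n := b)))"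
    unfolding * PiE_insert_eq
    by (subst sum.reindex[OF inj_combinator]) (auto intro!: sum.cong)
  then show ?thesis
    by (simp add: sum.cartesian_product)
qed

lemma chain_sum_eq_sum_PiE:
  assumes "finite A"
  shows "chain_sum R A v n a = (\<Sum>g\<in>{1..n} \<rightarrow>\<^sub>E A.
    if \<forall>k\<in>{1..n}. R k (g k) (if k = n then a else g (Suc k)) then \<Prod>k=1..n. v (g k) else 0)"
proof (induction n arbitrary: a)
  case 0
  then show ?case by simp
next
  case (Suc n)
  have *: "(\<forall>k\<in>{1..Suc n}. R k ((g(Suc n := b)) k)
        (if k = Suc n then a else (g(Suc n := b)) (Suc k))) \<longleftrightarrow>
      R (Suc n) b a \<and> (\<forall>k\<in>{1..n}. R k (g k) (if k = n then b else g (Suc k)))" for g b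
    by (auto simp: atLeastAtMostSuc_conv)
  have **: "(\<Prod>k=1..Suc n. v ((g(Suc n := b)) k)) = v b * (\<Prod>k=1..n. v (g k))" for g b
    by (simp add: mult.commute)
  show ?case
    unfolding sum_PiE_Suc[OF assms] * ** chain_sum.simps Suc.IH
    by (intro sum.cong refl) (simp add: sum_distrib_left if_distrib cong: if_cong)
qed

text \<open>The relation at position k sees \<open>w\<close> only through its letters at k and k +
  1, so \<open>w\<close> and the word governed by it merge into one chain of pairs. The last pair is
  peeled off and becomes the sentinel for the rest.\<close>

lemma chain_sum_pairs:
  assumes "finite A" "finite B"
  shows "(\<Sum>w\<in>{1..n} \<rightarrow>\<^sub>E B. (\<Prod>k=1..n. u (w k)) *
      chain_sum (\<lambda>k. R (S (w k) (if k = n then b else w (Suc k)))) A v n a) =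
    chain_sum (\<lambda>_ (a', b') (a, b). R (S b' b) a' a) (A \<times> B) (\<lambda>(a, b). v a * u b) n (a, b)"
proof (induction n arbitrary: a b)
  case 0
  then show ?case by simp
next
  case (Suc n)
  have cs: "chain_sum (\<lambda>k. R (S ((w(Suc n := c)) k)
        (if k = Suc n then b else (w(Suc n := c)) (Suc k)))) A v n a' =
      chain_sum (\<lambda>k. R (S (w k) (if k = n then c else w (Suc k)))) A v n a'" for w c a'
    by (rule chain_sum_cong) auto
  have pr: "(\<Prod>k=1..Suc n. u ((w(Suc n := c)) k)) = u c * (\<Prod>k=1..n. u (w k))" for w c
    by (simp add: mult.commute)
  have "(\<Sum>w\<in>{1..Suc n} \<rightarrow>\<^sub>E B. (\<Prod>k=1..Suc n. u (w k)) *
      chain_sum (\<lambda>k. R (S (w k) (if k = Suc n then b else w (Suc k)))) A v (Suc n) a) =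
     (\<Sum>c\<in>B. \<Sum>w\<in>{1..n} \<rightarrow>\<^sub>E B. \<Sum>a'\<in>A. if R (S c b) a' a then v a' * u c *
        ((\<Prod>k=1..n. u (w k)) *
         chain_sum (\<lambda>k. R (S (w k) (if k = n then c else w (Suc k)))) A v n a') else 0)"
    unfolding sum_PiE_Suc[OF assms(2)] pr chain_sum.simps(2) cs
    by (intro sum.cong refl)
       (simp add: sum_distrib_left if_distrib algebra_simps cong: if_cong)
  also have "\<dots> = (\<Sum>c\<in>B. \<Sum>a'\<in>A. if R (S c b) a' a then v a' * u c *
      (\<Sum>w\<in>{1..n} \<rightarrow>\<^sub>E B. (\<Prod>k=1..n. u (w k)) *
         chain_sum (\<lambda>k. R (S (w k) (if k = n then c else w (Suc k)))) A v n a') else 0)"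
    by (intro sum.cong refl, subst sum.swap)
       (auto simp: sum_distrib_left intro!: sum.cong)
  also have "\<dots> = chain_sum (\<lambda>_ (a', b') (a, b). R (S b' b) a' a) (A \<times> B)
      (\<lambda>(a, b). v a * u b) (Suc n) (a, b)"
    unfolding Suc.IH chain_sum.simps
    by (subst sum.swap) (auto simp: sum.cartesian_product intro!: sum.cong)
  finally show ?case .
qed

section \<open>Generating functions of chains by length\<close>

lemma chain_sum_gf_step:
  fixes v :: "'l \<Rightarrow> 'a::comm_ring_1" and R :: "'l \<Rightarrow> 'l \<Rightarrow> bool"
  assumes "finite A"
  defines "e \<equiv> \<lambda>a. Abs_fps (\<lambda>n. chain_sum (\<lambda>_. R) A v n a)"
  shows "e a = 1 + fps_X * (\<Sum>b | b \<in> A \<and> R b a. fps_const (v b) * e b)"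
proof (rule fps_ext)
  fix n
  show "e a $ n = (1 + fps_X * (\<Sum>b | b \<in> A \<and> R b a. fps_const (v b) * e b)) $ n"
    using assms(1) by (cases n) (simp_all add: e_def fps_sum_nth sum.If_cases Int_def)
qed

text \<open>Letters are added in increasing order of \<open>key\<close>. A new largest letter can
  stand only at the end of a chain, so it contributes a geometric series if it may be repeated and a
  linear factor if not; denominators are cleared.\<close>

lemma chain_gf_product:
  fixes v :: "'l \<Rightarrow> 'a::comm_ring_1" and key :: "'l \<Rightarrow> nat"
  assumes "finite A" "inj_on key A"
    and "\<And>a. a \<in> A \<Longrightarrow> e a = 1 + fps_X * (\<Sum>b | b \<in> A \<and> R b a. fps_const (v b) * e b)"
    and "\<And>a b. a \<in> A \<Longrightarrow> b \<in> A \<Longrightarrow> R b a \<longleftrightarrow> key b < key a \<or> b = a \<and> r a"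
  shows "(1 + fps_X * (\<Sum>b\<in>A. fps_const (v b) * e b)) *
      (\<Prod>b\<in>A. if r b then 1 - fps_const (v b) * fps_X else 1) =
    (\<Prod>b\<in>A. if r b then 1 else 1 + fps_const (v b) * fps_X)"
  using assms
proof (induction A rule: finite_ranking_induct[where f = key])
  case empty
  then show ?case by simp
next
  case (insert a A)
  show ?case
  proof (cases "a \<in> A")
    case True
    then show ?thesis using insert by (simp add: insert_absorb)
  next
    case False
    have lt: "key b < key a" if "b \<in> A" for b
      using insert.hyps(2)[OF that] insert.prems(1) that False
      by (metis inj_onD insertCI le_neq_implies_less)
    define g where "g = 1 + fps_X * (\<Sum>b\<in>A. fps_const (v b) * e b)"
    have IH: "g * (\<Prod>b\<in>A. if r b then 1 - fps_const (v b) * fps_X else 1) =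
        (\<Prod>b\<in>A. if r b then 1 else 1 + fps_const (v b) * fps_X)"
      unfolding g_def
    proof (rule insert.IH)
      show "inj_on key A" using insert.prems(1) by (simp add: inj_on_insert)
      fix c assume c: "c \<in> A"
      \<comment> \<open>The largest letter never precedes a smaller one, so the equations for the
        smaller letters survive its removal.\<close>
      have "{b. b \<in> insert a A \<and> R b c} = {b. b \<in> A \<and> R b c}"
        using lt[OF c] insert.prems(3)[of c a] c False by auto
      then show "e c = 1 + fps_X * (\<Sum>b | b \<in> A \<and> R b c. fps_const (v b) * e b)"
        using insert.prems(2)[of c] c by simp
    qed (use insert.prems(3) in blast)
    have ea: "e a = (if r a then g + fps_X * (fps_const (v a) * e a) else g)"
    proof -
      have lower: "{b. b \<in> insert a A \<and> R b a} = (if r a then insert a A else A)"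
        using insert.prems(3)[of a] lt False by auto
      have "e a = 1 + fps_X * (\<Sum>b\<in>(if r a then insert a A else A). fps_const (v b) * e b)"
        unfolding lower[symmetric] by (rule insert.prems(2)) simp
      also have "\<dots> = (if r a then g + fps_X * (fps_const (v a) * e a) else g)"
        using False insert.hyps(1) by (simp add: g_def algebra_simps)
      finally show ?thesis .
    qed
    have g': "1 + fps_X * (\<Sum>b\<in>insert a A. fps_const (v b) * e b) =
        g + fps_X * (fps_const (v a) * e a)"
      using False insert.hyps(1) by (simp add: g_def algebra_simps)
    have factor: "(g + fps_X * (fps_const (v a) * e a)) * (if r a then 1 - fps_const (v a) * fps_X else 1) =
        (if r a then 1 else 1 + fps_const (v a) * fps_X) * g"
    proof (cases "r a")
      case True
      then have *: "e a = g + fps_X * (fps_const (v a) * e a)" using ea by simp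
      then have "g + fps_X * (fps_const (v a) * e a) = e a" by (rule sym)
      moreover have "e a * (1 - fps_const (v a) * fps_X) = e a - fps_X * (fps_const (v a) * e a)"
        by (simp add: algebra_simps)
      moreover have "\<dots> = g" using * by (simp add: diff_eq_eq)
      ultimately show ?thesis using True by simp
    next
      case False
      then have "e a = g" using ea by simp
      then show ?thesis using False by (simp add: algebra_simps)
    qed
    have "p * c = r * g \<Longrightarrow> g * D = N \<Longrightarrow> p * (c * D) = r * N" for p c r D N :: "'a fps"
      by (metis mult.assoc)
    from this[OF factor IH] show ?thesis
      unfolding g' prod.insert[OF insert.hyps(1) False] .
  qed
qed

section \<open>Enriched partitions with a given descent set\<close>

text \<open>The flag \<open>d\<close> tells whether the permutation descends between the two positions.\<close>

definition letter_compat :: "bool \<Rightarrow> nat \<Rightarrow> nat \<Rightarrow> bool" where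
  "letter_compat d b a \<longleftrightarrow> b < a \<or> b = a \<and> (odd a \<longleftrightarrow> d)"

text \<open>The flag selects the alphabet: \<^term>\<open>False\<close> for rows, \<^term>\<open>True\<close> for columns. Not having the
  letter \<open>0\<close> acts like a descent at position \<open>0\<close>, hence the use of \<open>d 0\<close> below.\<close>

definition letter_weight :: "bool \<Rightarrow> 'a \<Rightarrow> nat \<Rightarrow> 'a::comm_semiring_1" where
  "letter_weight d y c = (if c = 0 then of_bool (\<not> d) else if odd c then y else 1)"

text \<open>The numerator of the generating function by level. In the factor for position n + 1 the
  first summand belongs to an unsigned letter and the second to a signed one.\<close>

primrec transfer :: "(nat \<Rightarrow> bool) \<Rightarrow> 'a \<Rightarrow> 'a \<Rightarrow> nat \<Rightarrow> 'a::comm_semiring_1" where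
  "transfer d y s 0 = 1"
| "transfer d y s (Suc n) = transfer d y s n *
     ((if d n then s else 1) + (if d (Suc n) then y else y * s))"

lemma transfer_fps_const:
  "transfer d (fps_const y) (fps_const s) n = fps_const (transfer d y s n)"
  by (induction n) (simp_all flip: fps_const_1_eq_1)

lemma chain_sum_compat_atMost:
  assumes "a \<le> M" "a \<le> N"
  shows "chain_sum (\<lambda>k. letter_compat (d k)) {..M} v n a = chain_sum (\<lambda>k. letter_compat (d k)) {..N} v n a"
  using assms
proof (induction n arbitrary: a)
  case 0
  then show ?case by simp
next
  case (Suc n)
  have "chain_sum (\<lambda>k. letter_compat (d k)) {..K} v (Suc n) a =
      (\<Sum>b\<le>a. if letter_compat (d (Suc n)) b a then v b * chain_sum (\<lambda>k. letter_compat (d k)) {..K} v n b else 0)"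
    if "a \<le> K" for K
    unfolding chain_sum.simps
    by (rule sum.mono_neutral_right) (use that in \<open>auto simp: letter_compat_def\<close>)
  then show ?case
    using Suc by (simp cong: if_cong)
qed

text \<open>An odd letter may be repeated only at a descent. Without a descent at the last position
  the odd sentinel may therefore belong to the alphabet, as it never occurs in a word.\<close>

lemma chain_sum_compat_sentinel:
  assumes "\<not> d n" "even a"
  shows "chain_sum (\<lambda>k. letter_compat (d k)) {..a} v n (Suc a) =
    chain_sum (\<lambda>k. letter_compat (d k)) {..Suc a} v n (Suc a)"
proof (cases n)
  case (Suc m)
  show ?thesis
    unfolding Suc chain_sum.simps
    using assms Suc
    by (intro sum.mono_neutral_cong_left)
       (auto simp: letter_compat_def le_Suc_eq
         intro!: arg_cong2[where f = times] chain_sum_compat_atMost)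
qed simp

text \<open>Words are tracked by the parity of the letter that follows them: \<open>E\<close> for an
  unsigned and \<open>F\<close> for a signed one. By induction \<open>E\<close> is \<open>F\<close>
  times a factor that depends on \<open>d n\<close> alone, so each step multiplies a single series
  by a scalar.\<close>

lemma chain_sum_gf:
  fixes d :: "nat \<Rightarrow> bool" and y :: "'a::comm_ring_1"
  assumes "\<not> d n"
  shows "Abs_fps (\<lambda>m. chain_sum (\<lambda>k. letter_compat (d k)) {..2 * m} (letter_weight (d 0) y) n (2 * m + 1))
    * (1 - fps_X) ^ (n + 1) = transfer d (fps_const y) fps_X n"
proof -
  let ?v = "letter_weight (d 0) y"
  define c where "c n a = chain_sum (\<lambda>k. letter_compat (d k)) {..a} ?v n a" for n a
  have c_Suc: "c (Suc n) a = (\<Sum>b\<le>a. if letter_compat (d (Suc n)) b a then ?v b * c n b else 0)" for n a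
    unfolding c_def chain_sum.simps
    by (intro sum.cong refl if_cong arg_cong2[where f = times] chain_sum_compat_atMost) auto
  \<comment> \<open>The weight is included so that a missing letter 0 shifts \<open>E 0\<close> by
    \<open>fps_X\<close>, just as a descent at position 0 would.\<close>
  define E where "E n = Abs_fps (\<lambda>m. ?v (2 * m) * c n (2 * m))" for n
  define F where "F n = Abs_fps (\<lambda>m. c n (2 * m + 1))" for n
  define p where "p n = Abs_fps (\<lambda>m. \<Sum>b\<le>2 * m. ?v b * c n b)" for n
  define q where "q n = Abs_fps (\<lambda>m. \<Sum>b\<le>2 * m + 1. ?v b * c n b)" for n
  \<comment> \<open>Differences of consecutive partial sums leave two letters: 2m - 1 and 2m for
    \<open>p\<close>, 2m and 2m + 1 for \<open>q\<close>.\<close>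
  have p: "p n * (1 - fps_X) = E n + fps_const y * fps_X * F n" for n
  proof (rule fps_ext)
    fix m show "(p n * (1 - fps_X)) $ m = (E n + fps_const y * fps_X * F n) $ m"
      by (cases m) (simp_all add: p_def E_def F_def algebra_simps letter_weight_def)
  qed
  have q: "q n * (1 - fps_X) = E n + fps_const y * F n" for n
  proof (rule fps_ext)
    fix m show "(q n * (1 - fps_X)) $ m = (E n + fps_const y * F n) $ m"
      by (cases m) (simp_all add: q_def E_def F_def algebra_simps letter_weight_def)
  qed
  have False_step: "F (Suc n) = p n" "E (Suc n) = p n" if "\<not> d (Suc n)" for n
  proof -
    have "c (Suc n) (2 * m + 1) = p n $ m" for m
      unfolding c_Suc p_def using that
      by (auto simp: letter_compat_def intro!: sum.cong)
    then show "F (Suc n) = p n" by (simp add: F_def fps_eq_iff)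
    \<comment> \<open>At m = 0 the weight of the letter 0 occurs twice on the left and once on the
      right; being 0 or 1, it is idempotent.\<close>
    have "?v (2 * m) * c (Suc n) (2 * m) = p n $ m" for m
      unfolding c_Suc p_def using that
      by (cases m) (auto simp: letter_compat_def letter_weight_def intro!: sum.cong)
    then show "E (Suc n) = p n" by (simp add: E_def fps_eq_iff)
  qed
  have True_step: "F (Suc n) = q n" "E (Suc n) = fps_X * q n" if "d (Suc n)" for n
  proof -
    have "c (Suc n) (2 * m + 1) = q n $ m" for m
      unfolding c_Suc q_def using that
      by (auto simp: letter_compat_def intro!: sum.cong)
    then show "F (Suc n) = q n" by (simp add: F_def fps_eq_iff)
    have "?v (2 * m) * c (Suc n) (2 * m) = (fps_X * q n) $ m" for m
      unfolding c_Suc q_def using that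
      by (cases m) (auto simp: letter_compat_def letter_weight_def intro!: sum.cong)
    then show "E (Suc n) = fps_X * q n" by (simp add: E_def fps_eq_iff)
  qed
  have inv: "E n = (if d n then fps_X else 1) * F n \<and>
      F n * (1 - fps_X) ^ (n + 1) = transfer d (fps_const y) fps_X n" for n
  proof (induction n)
    case 0
    have "F 0 * (1 - fps_X) = 1"
    proof (rule fps_ext)
      fix m show "(F 0 * (1 - fps_X)) $ m = 1 $ m"
        by (cases m) (simp_all add: F_def c_def algebra_simps)
    qed
    moreover have "E 0 = (if d 0 then fps_X else 1) * F 0"
    proof (rule fps_ext)
      fix m show "E 0 $ m = ((if d 0 then fps_X else 1) * F 0) $ m"
        by (cases m) (simp_all add: E_def F_def c_def letter_weight_def)
    qed
    ultimately show ?case by simp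
  next
    case (Suc n)
    then have E: "E n = (if d n then fps_X else 1) * F n"
      and F: "F n * (1 - fps_X) ^ (n + 1) = transfer d (fps_const y) fps_X n" by auto
    have "F (Suc n) * (1 - fps_X) =
        ((if d n then fps_X else 1) + (if d (Suc n) then fps_const y else fps_const y * fps_X)) * F n"
      using False_step(1)[of n] True_step(1)[of n] p[of n] q[of n] unfolding E
      by (auto simp: ring_distribs mult.assoc)
    then have "F (Suc n) * (1 - fps_X) ^ (Suc n + 1) =
        ((if d n then fps_X else 1) + (if d (Suc n) then fps_const y else fps_const y * fps_X))
        * (F n * (1 - fps_X) ^ (n + 1))"
      by (metis (no_types) add_Suc mult.assoc mult.commute power_Suc)
    also have "\<dots> = transfer d (fps_const y) fps_X (Suc n)"
      unfolding F by (simp add: mult.commute)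
    finally show ?case
      using False_step True_step by auto
  qed
  have "chain_sum (\<lambda>k. letter_compat (d k)) {..2 * m} ?v n (2 * m + 1) = c n (2 * m + 1)" for m
    using chain_sum_compat_sentinel[of d n "2 * m"] assms by (simp add: c_def)
  then show ?thesis using inv[of n] by (simp add: F_def)
qed

text \<open>Away from descents a factor of \<open>transfer\<close> is \<open>1 + y * s\<close>; a
  maximal run of descents is opened by \<open>1 + y\<close>, continued by \<open>y + s\<close> and
  closed by \<open>s * (1 + y)\<close>. Hence \<open>S\<close> marks descents and \<open>Y\<close>
  marks openings of runs. While a run is open, the invariant supplies its closing factor. If
  \<open>d 0\<close> holds, a run is open from the start; \<open>D\<close> and \<open>L\<close> do
  not count position 0, and \<open>init\<close> makes up for this through \<open>g\<close> and
  \<open>q\<close>.\<close>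

lemma transfer_closed_form:
  fixes y s Y S g q :: "'a::comm_ring_1"
  assumes S: "S * (1 + y * s) = y + s" and Y: "Y * ((y + s) * (1 + y * s)) = (1 + y)\<^sup>2 * s"
    and init: "if d 0 then g * (s * (1 + y)) = q * (1 + y * s) else g = q"
  defines "D \<equiv> \<lambda>n. card {k \<in> {1..n}. d k}" and "L \<equiv> \<lambda>n. card {k \<in> {1..n}. d k \<and> \<not> d (k - 1)}"
  shows "if d n then g * transfer d y s n * (s * (1 + y)) = q * (1 + y * s) ^ (n + 1) * Y ^ L n * S ^ D n
    else g * transfer d y s n = q * (1 + y * s) ^ n * Y ^ L n * S ^ D n"
proof (induction n)
  case 0
  have "D 0 = 0" "L 0 = 0" by (simp_all add: D_def L_def)
  then show ?case using init by simp
next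
  case (Suc n)
  have card_Suc: "card {k \<in> {1..Suc n}. Q k} = card {k \<in> {1..n}. Q k} + of_bool (Q (Suc n))" for Q
  proof -
    have "{k \<in> {1..Suc n}. Q k} = {k \<in> {1..n}. Q k} \<union> (if Q (Suc n) then {Suc n} else {})"
      by (auto simp: le_Suc_eq)
    then show ?thesis by auto
  qed
  have D: "D (Suc n) = D n + of_bool (d (Suc n))"
    and L: "L (Suc n) = L n + of_bool (d (Suc n) \<and> \<not> d n)"
    unfolding D_def L_def card_Suc by simp_all
  \<comment> \<open>The opening and the closing factor of a run together make one \<open>Y\<close>,
    one \<open>S\<close> and two factors \<open>1 + y * s\<close>.\<close>
  have YS: "Y * S * (1 + y * s)\<^sup>2 = (1 + y)\<^sup>2 * s"
    using Y unfolding S[symmetric] by (simp add: power2_eq_square algebra_simps)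
  let ?w = "1 + y * s" and ?K = "transfer d y s n"
  consider "d n" "d (Suc n)" | "d n" "\<not> d (Suc n)" | "\<not> d n" "d (Suc n)" | "\<not> d n" "\<not> d (Suc n)"
    by blast
  then show ?case
  proof cases
    case 1
    then have "g * transfer d y s (Suc n) * (s * (1 + y)) = (g * ?K * (s * (1 + y))) * (y + s)"
      by (simp add: algebra_simps)
    also have "\<dots> = (q * ?w ^ (n + 1) * Y ^ L n * S ^ D n) * (S * ?w)"
      using Suc.IH 1 by (simp add: S)
    finally show ?thesis using 1 by (simp add: D L algebra_simps)
  next
    case 2
    then have "g * transfer d y s (Suc n) = g * ?K * (s * (1 + y))"
      by (simp add: algebra_simps)
    then show ?thesis using Suc.IH 2 by (simp add: D L)
  next
    case 3
    then have "g * transfer d y s (Suc n) * (s * (1 + y)) = (g * ?K) * ((1 + y)\<^sup>2 * s)"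
      by (simp add: algebra_simps power2_eq_square)
    also have "\<dots> = (q * ?w ^ n * Y ^ L n * S ^ D n) * (Y * S * ?w\<^sup>2)"
      using Suc.IH 3 by (simp add: YS)
    finally show ?thesis using 3 by (simp add: D L power2_eq_square mult_ac)
  next
    case 4
    then have "g * transfer d y s (Suc n) = (g * ?K) * ?w"
      by (simp add: algebra_simps)
    then show ?thesis using Suc.IH 4 by (simp add: D L mult_ac)
  qed
qed

section \<open>Standardization of signed words\<close>

lemma mult_add_less_mult_add_iff:
  fixes m p q u v :: nat
  assumes "p < m" "q < m"
  shows "u * m + p < v * m + q \<longleftrightarrow> u < v \<or> u = v \<and> p < q"
proof -
  have *: "u * m + p < v * m + q" if "u < v" "p < m" for u v p q
  proof -
    have "Suc u * m \<le> v * m" using that(1) by (intro mult_le_mono1) simp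
    then show ?thesis using that(2) unfolding mult_Suc by linarith
  qed
  show ?thesis
    using *[of u v p q] *[of v u q p] assms by (cases u v rule: linorder_cases) auto
qed

text \<open>Existence and uniqueness both rest on the rank: i must be sent to the number of
  positions whose key is at most \<open>key i\<close>.\<close>

lemma ex1_permutation_sorting:
  fixes key :: "nat \<Rightarrow> nat"
  assumes "inj_on key {1..n}"
  shows "\<exists>!\<pi>. \<pi> permutes {1..n} \<and> (\<forall>a\<in>{1..n}. \<forall>b\<in>{1..n}. \<pi> a < \<pi> b \<longleftrightarrow> key a < key b)"
proof (rule ex_ex1I)
  define r where "r i = (if i \<in> {1..n} then card {j \<in> {1..n}. key j \<le> key i} else i)" for i
  have less: "r a < r b" if "a \<in> {1..n}" "b \<in> {1..n}" "key a < key b" for a b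
  proof -
    have "b \<in> {j \<in> {1..n}. key j \<le> key b} - {j \<in> {1..n}. key j \<le> key a}"
      "{j \<in> {1..n}. key j \<le> key a} \<subseteq> {j \<in> {1..n}. key j \<le> key b}"
      using that by auto
    then have "{j \<in> {1..n}. key j \<le> key a} \<subset> {j \<in> {1..n}. key j \<le> key b}"
      by blast
    then show ?thesis using that unfolding r_def by (simp add: psubset_card_mono)
  qed
  have iff: "r a < r b \<longleftrightarrow> key a < key b" if "a \<in> {1..n}" "b \<in> {1..n}" for a b
    using less[of a b] less[of b a] that inj_onD[OF assms, of a b]
    by (metis linorder_neqE_nat order_less_asym)
  have inj: "inj_on r {1..n}"
    using iff inj_onD[OF assms] by (metis inj_onI linorder_neqE_nat order_less_irrefl)
  have into: "r ` {1..n} \<subseteq> {1..n}"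
  proof
    fix k assume "k \<in> r ` {1..n}"
    then obtain i where i: "i \<in> {1..n}" "k = r i" by auto
    have "card {j \<in> {1..n}. key j \<le> key i} \<le> card {1..n}" by (rule card_mono) auto
    moreover have "card {j \<in> {1..n}. key j \<le> key i} \<ge> 1"
      using i by (auto simp: Suc_le_eq card_gt_0_iff)
    ultimately show "k \<in> {1..n}" unfolding i(2) r_def if_P[OF i(1)] by simp
  qed
  have "bij_betw r {1..n} {1..n}"
    by (rule bij_betw_imageI[OF inj endo_inj_surj[OF finite_atLeastAtMost into inj]])
  then have "r permutes {1..n}"
    by (rule bij_imp_permutes) (auto simp: r_def)
  then show "\<exists>\<pi>. \<pi> permutes {1..n} \<and> (\<forall>a\<in>{1..n}. \<forall>b\<in>{1..n}. \<pi> a < \<pi> b \<longleftrightarrow> key a < key b)"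
    using iff by blast
next
  have rank: "\<pi> i = card {j \<in> {1..n}. key j \<le> key i}"
    if "\<pi> permutes {1..n}" "\<forall>a\<in>{1..n}. \<forall>b\<in>{1..n}. \<pi> a < \<pi> b \<longleftrightarrow> key a < key b" "i \<in> {1..n}" for \<pi> i
  proof -
    have le: "\<pi> j \<le> \<pi> i \<longleftrightarrow> key j \<le> key i" if "j \<in> {1..n}" for j
      using \<open>\<forall>a\<in>{1..n}. \<forall>b\<in>{1..n}. \<pi> a < \<pi> b \<longleftrightarrow> key a < key b\<close> \<open>i \<in> {1..n}\<close> that
      by (meson not_less)
    have "\<pi> ` {j \<in> {1..n}. key j \<le> key i} = {1..\<pi> i}"
    proof (intro equalityI subsetI)
      fix k assume "k \<in> \<pi> ` {j \<in> {1..n}. key j \<le> key i}"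
      then show "k \<in> {1..\<pi> i}"
        using le permutes_in_image[OF that(1)] by fastforce
    next
      fix k assume k: "k \<in> {1..\<pi> i}"
      then have "k \<in> {1..n}" using permutes_in_image[OF that(1), of i] that(3) by auto
      then have "k \<in> \<pi> ` {1..n}" using permutes_image[OF that(1)] by simp
      then obtain j where "j \<in> {1..n}" "k = \<pi> j" by auto
      then show "k \<in> \<pi> ` {j \<in> {1..n}. key j \<le> key i}"
        using k le by auto
    qed
    moreover have "inj_on \<pi> {j \<in> {1..n}. key j \<le> key i}"
      using permutes_inj_on[OF that(1)] .
    ultimately show ?thesis using card_image[of \<pi> "{j \<in> {1..n}. key j \<le> key i}"] by simp
  qed
  fix \<pi> \<rho>
  assume *: "\<pi> permutes {1..n} \<and> (\<forall>a\<in>{1..n}. \<forall>b\<in>{1..n}. \<pi> a < \<pi> b \<longleftrightarrow> key a < key b)"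
    "\<rho> permutes {1..n} \<and> (\<forall>a\<in>{1..n}. \<forall>b\<in>{1..n}. \<rho> a < \<rho> b \<longleftrightarrow> key a < key b)"
  show "\<pi> = \<rho>"
  proof
    fix i show "\<pi> i = \<rho> i"
      using * rank[of \<pi> i] rank[of \<rho> i] by (cases "i \<in> {1..n}") (auto simp: permutes_not_in)
  qed
qed

text \<open>Descents of the standardization, which numbers equal signed letters from right to left.\<close>

definition super_descent :: "nat \<Rightarrow> nat \<Rightarrow> bool" where
  "super_descent b a \<longleftrightarrow> a < b \<or> a = b \<and> odd a"

text \<open>Read along \<open>inv \<pi>\<close>, the word is a compatible chain. Equal even letters
  are then read from left to right and equal odd ones from right to left, which amounts to sorting
  the positions by a key without ties. Comparing the keys of neighbouring positions gives the
  descents.\<close>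

lemma standardization:
  fixes w :: "nat \<Rightarrow> nat" and n :: nat
  defines "sorts \<equiv> \<lambda>\<pi>. \<forall>k\<in>{1..<n}.
    letter_compat (inv \<pi> k > inv \<pi> (Suc k)) (w (inv \<pi> k)) (w (inv \<pi> (Suc k)))"
  shows "\<exists>!\<pi>. \<pi> permutes {1..n} \<and> sorts \<pi>"
    and "\<pi> permutes {1..n} \<Longrightarrow> sorts \<pi> \<Longrightarrow> k \<in> {1..<n} \<Longrightarrow>
      \<pi> k > \<pi> (Suc k) \<longleftrightarrow> super_descent (w k) (w (Suc k))"
proof -
  \<comment> \<open>A two-digit number in base \<open>Suc n\<close>: the letter decides first, then
    the position, reversed for odd letters.\<close>
  define key where "key i = w i * Suc n + (if odd (w i) then n - i else i)" for i
  have key_less: "key a < key b \<longleftrightarrow> w a < w b \<or> w a = w b \<and> (if odd (w a) then b < a else a < b)"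
    if "a \<in> {1..n}" "b \<in> {1..n}" for a b
  proof -
    have "(if odd (w i) then n - i else i) < Suc n" if "i \<in> {1..n}" for i
      using that by auto
    then show ?thesis
      using that unfolding key_def by (subst mult_add_less_mult_add_iff) auto
  qed
  have inj: "inj_on key {1..n}"
    by (rule inj_onI) (metis key_less linorder_neqE_nat order_less_irrefl)
  have sorts_iff: "sorts \<pi> \<longleftrightarrow> (\<forall>a\<in>{1..n}. \<forall>b\<in>{1..n}. \<pi> a < \<pi> b \<longleftrightarrow> key a < key b)"
    if \<pi>: "\<pi> permutes {1..n}" for \<pi>
  proof -
    have in_range: "inv \<pi> k \<in> {1..n}" if "k \<in> {1..n}" for k
      using permutes_in_image[OF permutes_inv[OF \<pi>]] that by blast
    have inv_neq: "inv \<pi> k \<noteq> inv \<pi> (Suc k)" for k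
      using permutes_inj[OF permutes_inv[OF \<pi>]] by (metis injD n_not_Suc_n)
    have step: "letter_compat (inv \<pi> k > inv \<pi> (Suc k)) (w (inv \<pi> k)) (w (inv \<pi> (Suc k))) \<longleftrightarrow>
        key (inv \<pi> k) < key (inv \<pi> (Suc k))" if "k \<in> {1..<n}" for k
      using key_less[OF in_range[of k] in_range[of "Suc k"]] inv_neq[of k] that
      by (auto simp: letter_compat_def)
    have \<pi>inv: "\<pi> (inv \<pi> k) = k" "inv \<pi> (\<pi> k) = k" for k
      using permutes_inverses[OF \<pi>] by auto
    show ?thesis
    proof
      assume s: "sorts \<pi>"
      have mono: "key (inv \<pi> k) < key (inv \<pi> l)" if "1 \<le> k" "k < l" "l \<le> n" for k l
        using that(2,1,3)
      proof (induction k l rule: less_Suc_induct)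
        case (1 i)
        then show ?case using s step[of i] by (simp add: sorts_def)
      next
        case (2 i j k)
        then show ?case by linarith
      qed
      have less: "key a < key b" if "a \<in> {1..n}" "b \<in> {1..n}" "\<pi> a < \<pi> b" for a b
        using mono[of "\<pi> a" "\<pi> b"] that \<pi>inv permutes_in_image[OF \<pi>] by (metis atLeastAtMost_iff)
      show "\<forall>a\<in>{1..n}. \<forall>b\<in>{1..n}. \<pi> a < \<pi> b \<longleftrightarrow> key a < key b"
        using less by (metis \<pi>inv(2) linorder_neqE_nat order_less_asym)
    next
      assume mono: "\<forall>a\<in>{1..n}. \<forall>b\<in>{1..n}. \<pi> a < \<pi> b \<longleftrightarrow> key a < key b"
      have "key (inv \<pi> k) < key (inv \<pi> (Suc k))" if k: "k \<in> {1..<n}" for k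
      proof -
        have "\<pi> (inv \<pi> k) < \<pi> (inv \<pi> (Suc k)) \<longleftrightarrow> key (inv \<pi> k) < key (inv \<pi> (Suc k))"
          by (intro mono[rule_format] in_range) (use k in auto)
        then show ?thesis by (simp add: \<pi>inv)
      qed
      then show "sorts \<pi>"
        unfolding sorts_def using step by simp
    qed
  qed
  show "\<exists>!\<pi>. \<pi> permutes {1..n} \<and> sorts \<pi>"
    using ex1_permutation_sorting[OF inj] sorts_iff by (metis (no_types, lifting))
  assume "\<pi> permutes {1..n}" "sorts \<pi>" "k \<in> {1..<n}"
  then show "\<pi> k > \<pi> (Suc k) \<longleftrightarrow> super_descent (w k) (w (Suc k))"
    using sorts_iff[of \<pi>] key_less[of "Suc k" k] by (auto simp: super_descent_def)
qed

text \<open>Here \<open>g\<close> is the sorted rearrangement of \<open>w = g \<circ> \<pi>\<close>.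
  After exchanging the sums, only the standardization of each \<open>w\<close> remains.
  \<open>Q\<close> may depend only on positions below n, where the descents of the standardization
  are determined by \<open>w\<close>.\<close>

lemma sum_over_permutations_standardize:
  fixes u :: "nat \<Rightarrow> 'a::comm_semiring_1" and Q :: "(nat \<Rightarrow> bool) \<Rightarrow> 'a"
  assumes Q: "\<And>d d'. (\<And>k. k \<in> {1..<n} \<Longrightarrow> d k = d' k) \<Longrightarrow> Q d = Q d'"
  shows "(\<Sum>\<pi> | \<pi> permutes {1..n}. Q (\<lambda>k. \<pi> k > \<pi> (Suc k)) * (\<Sum>g\<in>{1..n} \<rightarrow>\<^sub>E B.
      if \<forall>k\<in>{1..<n}. letter_compat (inv \<pi> k > inv \<pi> (Suc k)) (g k) (g (Suc k)) then \<Prod>k=1..n. u (g k) else 0)) =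
    (\<Sum>w\<in>{1..n} \<rightarrow>\<^sub>E B. (\<Prod>k=1..n. u (w k)) * Q (\<lambda>k. super_descent (w k) (w (Suc k))))"
proof -
  define sorts where "sorts w \<pi> \<longleftrightarrow> (\<forall>k\<in>{1..<n}.
    letter_compat (inv \<pi> k > inv \<pi> (Suc k)) (w (inv \<pi> k)) (w (inv \<pi> (Suc k))))" for w :: "nat \<Rightarrow> nat" and \<pi>
  have comp: "g \<circ> \<sigma> \<in> {1..n} \<rightarrow>\<^sub>E B" if "g \<in> {1..n} \<rightarrow>\<^sub>E B" "\<sigma> permutes {1..n}" for g \<sigma>
    using that permutes_in_image[OF that(2)] by (auto simp: PiE_iff extensional_def permutes_not_in)
  have inner: "(\<Sum>g\<in>{1..n} \<rightarrow>\<^sub>E B.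
      if \<forall>k\<in>{1..<n}. letter_compat (inv \<pi> k > inv \<pi> (Suc k)) (g k) (g (Suc k)) then \<Prod>k=1..n. u (g k) else 0) =
     (\<Sum>w\<in>{1..n} \<rightarrow>\<^sub>E B. if sorts w \<pi> then \<Prod>k=1..n. u (w k) else 0)"
    if \<pi>: "\<pi> permutes {1..n}" for \<pi>
  \<comment> \<open>For fixed \<open>\<pi>\<close>, composition with \<open>\<pi>\<close> permutes
    the words and preserves the product of the weights.\<close>
  proof (rule sum.reindex_bij_witness[where i = "\<lambda>w. w \<circ> inv \<pi>" and j = "\<lambda>g. g \<circ> \<pi>"])
    have \<pi>inv: "\<pi> (inv \<pi> k) = k" "inv \<pi> (\<pi> k) = k" for k
      using permutes_inverses[OF \<pi>] by auto
    fix g assume g: "g \<in> {1..n} \<rightarrow>\<^sub>E B"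
    show "g \<circ> \<pi> \<circ> inv \<pi> = g" "g \<circ> inv \<pi> \<circ> \<pi> = g"
      by (auto simp: \<pi>inv)
    show "g \<circ> \<pi> \<in> {1..n} \<rightarrow>\<^sub>E B" "g \<circ> inv \<pi> \<in> {1..n} \<rightarrow>\<^sub>E B"
      using comp[OF g] \<pi> permutes_inv[OF \<pi>] by auto
    have "(\<Prod>k=1..n. u ((g \<circ> \<pi>) k)) = (\<Prod>k=1..n. u (g k))"
      using prod.permute[OF \<pi>, of "\<lambda>k. u (g k)"] by (simp add: o_def)
    then show "(if sorts (g \<circ> \<pi>) \<pi> then \<Prod>k=1..n. u ((g \<circ> \<pi>) k) else 0) =
      (if \<forall>k\<in>{1..<n}. letter_compat (inv \<pi> k > inv \<pi> (Suc k)) (g k) (g (Suc k)) then \<Prod>k=1..n. u (g k) else 0)"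
      by (simp add: sorts_def \<pi>inv)
  qed
  have "(\<Sum>\<pi> | \<pi> permutes {1..n}. Q (\<lambda>k. \<pi> k > \<pi> (Suc k)) * (\<Sum>g\<in>{1..n} \<rightarrow>\<^sub>E B.
      if \<forall>k\<in>{1..<n}. letter_compat (inv \<pi> k > inv \<pi> (Suc k)) (g k) (g (Suc k)) then \<Prod>k=1..n. u (g k) else 0)) =
     (\<Sum>\<pi> | \<pi> permutes {1..n}. \<Sum>w\<in>{1..n} \<rightarrow>\<^sub>E B.
        if sorts w \<pi> then (\<Prod>k=1..n. u (w k)) * Q (\<lambda>k. \<pi> k > \<pi> (Suc k)) else 0)"
  proof (rule sum.cong[OF refl])
    fix \<pi> assume "\<pi> \<in> {\<pi>. \<pi> permutes {1..n}}"
    then have \<pi>: "\<pi> permutes {1..n}" by simp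
    show "Q (\<lambda>k. \<pi> k > \<pi> (Suc k)) * (\<Sum>g\<in>{1..n} \<rightarrow>\<^sub>E B.
        if \<forall>k\<in>{1..<n}. letter_compat (inv \<pi> k > inv \<pi> (Suc k)) (g k) (g (Suc k))
        then \<Prod>k=1..n. u (g k) else 0) =
      (\<Sum>w\<in>{1..n} \<rightarrow>\<^sub>E B.
        if sorts w \<pi> then (\<Prod>k=1..n. u (w k)) * Q (\<lambda>k. \<pi> k > \<pi> (Suc k)) else 0)"
      unfolding inner[OF \<pi>] sum_distrib_left by (intro sum.cong) (simp_all add: mult.commute)
  qed
  also have "\<dots> = (\<Sum>w\<in>{1..n} \<rightarrow>\<^sub>E B. \<Sum>\<pi> | \<pi> permutes {1..n}.
        if sorts w \<pi> then (\<Prod>k=1..n. u (w k)) * Q (\<lambda>k. \<pi> k > \<pi> (Suc k)) else 0)"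
    by (rule sum.swap)
  also have "\<dots> = (\<Sum>w\<in>{1..n} \<rightarrow>\<^sub>E B. (\<Prod>k=1..n. u (w k)) * Q (\<lambda>k. super_descent (w k) (w (Suc k))))"
  proof (rule sum.cong[OF refl])
    fix w
    obtain \<rho> where \<rho>: "\<rho> permutes {1..n}" "sorts w \<rho>"
      and uniq: "\<And>\<pi>. \<pi> permutes {1..n} \<Longrightarrow> sorts w \<pi> \<Longrightarrow> \<pi> = \<rho>"
      using standardization(1)[of n w] unfolding sorts_def by blast
    have "Q (\<lambda>k. \<rho> k > \<rho> (Suc k)) = Q (\<lambda>k. super_descent (w k) (w (Suc k)))"
      using standardization(2)[of \<rho> n w] \<rho> unfolding sorts_def by (intro Q) blast
    moreover have "(\<Sum>\<pi> | \<pi> permutes {1..n}.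
        if sorts w \<pi> then (\<Prod>k=1..n. u (w k)) * Q (\<lambda>k. \<pi> k > \<pi> (Suc k)) else 0) =
      (\<Sum>\<pi>\<in>{\<rho>}. (\<Prod>k=1..n. u (w k)) * Q (\<lambda>k. \<pi> k > \<pi> (Suc k)))"
    proof -
      have "{\<pi> \<in> {\<pi>. \<pi> permutes {1..n}}. sorts w \<pi>} = {\<rho>}"
        using \<rho> uniq by blast
      then show ?thesis
        by (subst sum.inter_filter[symmetric]) (simp_all only: finite_permutations finite_atLeastAtMost)
    qed
    ultimately show "(\<Sum>\<pi> | \<pi> permutes {1..n}.
        if sorts w \<pi> then (\<Prod>k=1..n. u (w k)) * Q (\<lambda>k. \<pi> k > \<pi> (Suc k)) else 0) =
      (\<Prod>k=1..n. u (w k)) * Q (\<lambda>k. super_descent (w k) (w (Suc k)))"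
      by simp
  qed
  finally show ?thesis .
qed

section \<open>Biwords\<close>

lemma prod_atMost_parity:
  assumes "\<And>c. even c \<Longrightarrow> c > 0 \<Longrightarrow> f c = p" "\<And>c. odd c \<Longrightarrow> f c = q"
  shows "(\<Prod>c\<le>2 * i. f c) = f (0 :: nat) * (p * q) ^ i"
  by (induction i) (simp_all add: assms mult_ac)

lemma power_mult_distrib_regroup:
  fixes p q :: "'a::comm_monoid_mult"
  shows "p ^ j * (p ^ j * q ^ j) ^ i = q ^ (i * j) * p ^ ((i + 1) * j)"
proof -
  have exps: "p ^ ((i + 1) * j) = p ^ j * (p ^ j) ^ i" "q ^ (i * j) = (q ^ j) ^ i"
    by (simp_all add: power_add mult.commute[of i j] power_mult)
  show ?thesis
    unfolding exps power_mult_distrib by (simp only: mult_ac)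
qed

definition pair_compat :: "nat \<times> nat \<Rightarrow> nat \<times> nat \<Rightarrow> bool" where
  "pair_compat = (\<lambda>(a', b') (a, b). letter_compat (super_descent b' b) a' a)"

text \<open>This will be the coefficient of \<open>x^n s^i t^j\<close> on both sides of the
  identity. The sentinel lies above both alphabets.\<close>

definition biword_sum :: "'a \<Rightarrow> 'a \<Rightarrow> nat \<Rightarrow> nat \<Rightarrow> nat \<Rightarrow> 'a::comm_semiring_1" where
  "biword_sum y z i j n = chain_sum (\<lambda>_. pair_compat) ({..2 * i} \<times> {..2 * j})
     (\<lambda>(a, b). letter_weight False y a * letter_weight True z b) n (2 * i + 1, 2 * j + 1)"

text \<open>The order is lexicographic, except that column letters run backwards under an odd row
  letter; \<open>key\<close> makes it numerical. For equal pairs the parity rules of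
  \<open>letter_compat\<close> and \<open>super_descent\<close> combine to agreement of the
  signs.\<close>

lemma pair_compat_iff:
  fixes j :: nat
  defines "key \<equiv> \<lambda>(a, b). a * (2 * j + 1) + (if odd a then 2 * j - b else b)"
  assumes "p \<in> UNIV \<times> {..2 * j}" "q \<in> UNIV \<times> {..2 * j}"
  shows "pair_compat q p \<longleftrightarrow> key q < key p \<or> q = p \<and> even (fst p + snd p)"
    and "key q = key p \<Longrightarrow> q = p"
proof -
  obtain a b a' b' where pq: "p = (a, b)" "q = (a', b')" and b: "b \<le> 2 * j" "b' \<le> 2 * j"
    using assms by auto
  have off: "(if odd c then 2 * j - d else d) < 2 * j + 1" if "d \<le> 2 * j" for c d :: nat
    using that by auto
  have less: "key (c, d) < key (c', d') \<longleftrightarrow> c < c' \<or> c = c' \<and> (if odd c then d' < d else d < d')"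
    if "d \<le> 2 * j" "d' \<le> 2 * j" for c d c' d'
    unfolding key_def case_prod_conv mult_add_less_mult_add_iff[OF off[OF that(1)] off[OF that(2)]]
    using that by auto
  show "pair_compat q p \<longleftrightarrow> key q < key p \<or> q = p \<and> even (fst p + snd p)"
    using b by (auto simp: pq less pair_compat_def letter_compat_def super_descent_def)
  show "q = p" if "key q = key p"
    using less[OF b] less[OF b(2,1)] that by (metis pq linorder_neqE_nat less_irrefl)
qed

text \<open>Apart from the column letter 0 of weight 0, there are (i + 1) j unsigned pairs of weight
  1 and i j signed pairs of weight y z, which may be repeated, and i j mixed pairs of weight y and
  (i + 1) j of weight z, which may not.\<close>

lemma biword_gf:
  fixes y z :: "'a::comm_ring_1"
  shows "Abs_fps (biword_sum y z i j) *
      ((1 - fps_const y * fps_const z * fps_X) ^ (i * j) * (1 - fps_X) ^ ((i + 1) * j)) =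
    (1 + fps_const y * fps_X) ^ (i * j) * (1 + fps_const z * fps_X) ^ ((i + 1) * j)"
proof -
  let ?A = "{..2 * i} \<times> {..2 * j}"
  let ?y = "letter_weight False y" and ?z = "letter_weight True z"
  let ?v = "\<lambda>(a, b). ?y a * ?z b"
  let ?r = "\<lambda>p. even (fst p + snd p :: nat)"
  define e where "e p = Abs_fps (\<lambda>n. chain_sum (\<lambda>_. pair_compat) ?A ?v n p)" for p
  have e: "e p = 1 + fps_X * (\<Sum>q | q \<in> ?A \<and> pair_compat q p. fps_const (?v q) * e q)" for p
    unfolding e_def by (rule chain_sum_gf_step) simp
  have "{q. q \<in> ?A \<and> pair_compat q (2 * i + 1, 2 * j + 1)} = ?A"
    by (auto simp: pair_compat_def letter_compat_def)
  then have top: "Abs_fps (biword_sum y z i j) = 1 + fps_X * (\<Sum>q\<in>?A. fps_const (?v q) * e q)"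
    using e[of "(2 * i + 1, 2 * j + 1)"] by (simp add: e_def biword_sum_def[abs_def])
  have den: "(\<Prod>q\<in>?A. if ?r q then 1 - fps_const (?v q) * fps_X else 1) =
      (1 - fps_const y * fps_const z * fps_X) ^ (i * j) * (1 - fps_X) ^ ((i + 1) * j)"
  proof -
    have "(\<Prod>q\<in>?A. if ?r q then 1 - fps_const (?v q) * fps_X else 1) =
       (\<Prod>a\<le>2 * i. \<Prod>b\<le>2 * j. if even (a + b) then 1 - fps_const (?y a * ?z b) * fps_X else 1)"
      by (auto simp: prod.cartesian_product intro!: prod.cong)
    also have "\<dots> = (\<Prod>a\<le>2 * i. if even a then (1 - fps_X) ^ j
        else (1 - fps_const y * fps_const z * fps_X) ^ j)"
    proof (rule prod.cong[OF refl])
      fix a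
      show "(\<Prod>b\<le>2 * j. if even (a + b) then 1 - fps_const (?y a * ?z b) * fps_X else 1) =
        (if even a then (1 - fps_X) ^ j else (1 - fps_const y * fps_const z * fps_X) ^ j)"
        by (subst prod_atMost_parity[where p = "if even a then 1 - fps_X else 1"
              and q = "if even a then 1 else 1 - fps_const y * fps_const z * fps_X"])
           (auto simp: letter_weight_def)
    qed
    also have "\<dots> = (1 - fps_X) ^ j * ((1 - fps_X) ^ j * (1 - fps_const y * fps_const z * fps_X) ^ j) ^ i"
      by (subst prod_atMost_parity[where p = "(1 - fps_X) ^ j"
            and q = "(1 - fps_const y * fps_const z * fps_X) ^ j"]) auto
    finally show ?thesis
      by (simp only: power_mult_distrib_regroup)
  qed
  have num: "(\<Prod>q\<in>?A. if ?r q then 1 else 1 + fps_const (?v q) * fps_X) =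
      (1 + fps_const y * fps_X) ^ (i * j) * (1 + fps_const z * fps_X) ^ ((i + 1) * j)"
  proof -
    have "(\<Prod>q\<in>?A. if ?r q then 1 else 1 + fps_const (?v q) * fps_X) =
       (\<Prod>a\<le>2 * i. \<Prod>b\<le>2 * j. if even (a + b) then 1 else 1 + fps_const (?y a * ?z b) * fps_X)"
      by (auto simp: prod.cartesian_product intro!: prod.cong)
    also have "\<dots> = (\<Prod>a\<le>2 * i. if even a then (1 + fps_const z * fps_X) ^ j
        else (1 + fps_const y * fps_X) ^ j)"
    proof (rule prod.cong[OF refl])
      fix a
      show "(\<Prod>b\<le>2 * j. if even (a + b) then 1 else 1 + fps_const (?y a * ?z b) * fps_X) =
        (if even a then (1 + fps_const z * fps_X) ^ j else (1 + fps_const y * fps_X) ^ j)"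
        by (subst prod_atMost_parity[where p = "if even a then 1 else 1 + fps_const y * fps_X"
              and q = "if even a then 1 + fps_const z * fps_X else 1"])
           (auto simp: letter_weight_def)
    qed
    also have "\<dots> = (1 + fps_const z * fps_X) ^ j *
        ((1 + fps_const z * fps_X) ^ j * (1 + fps_const y * fps_X) ^ j) ^ i"
      by (subst prod_atMost_parity[where p = "(1 + fps_const z * fps_X) ^ j"
            and q = "(1 + fps_const y * fps_X) ^ j"]) auto
    finally show ?thesis
      by (simp only: power_mult_distrib_regroup)
  qed
  have "(1 + fps_X * (\<Sum>q\<in>?A. fps_const (?v q) * e q)) *
      (\<Prod>q\<in>?A. if ?r q then 1 - fps_const (?v q) * fps_X else 1) =
    (\<Prod>q\<in>?A. if ?r q then 1 else 1 + fps_const (?v q) * fps_X)"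
  proof (rule chain_gf_product[where R = pair_compat])
    let ?key = "\<lambda>(a, b). a * (2 * j + 1) + (if odd a then 2 * j - b else b)"
    show "inj_on ?key ?A"
      by (rule inj_onI) (rule pair_compat_iff(2)[where j = j]; auto)
    show "pair_compat q p \<longleftrightarrow> ?key q < ?key p \<or> q = p \<and> ?r p" if "p \<in> ?A" "q \<in> ?A" for p q
      by (rule pair_compat_iff(1)) (use that in auto)
  qed (simp, rule e)
  then show ?thesis unfolding top den num .
qed

text \<open>The column chain is the sorted form of a word with standardization \<open>\<pi>\<close>.
  The descents of \<open>\<pi>\<close>, which govern the row chain, are the super descents of that
  word, so both merge into a chain of pairs.\<close>

lemma sum_permutations_chain_sum:
  fixes y z :: "'a::comm_semiring_1"
  shows "(\<Sum>\<pi> | \<pi> permutes {1..n}.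
      chain_sum (\<lambda>k. letter_compat (\<pi> k > \<pi> (Suc k))) {..2 * i} (letter_weight False y) n (2 * i + 1) *
      chain_sum (\<lambda>k. letter_compat (inv \<pi> k > inv \<pi> (Suc k))) {..2 * j} (letter_weight True z) n (2 * j + 1))
    = biword_sum y z i j n"
proof -
  let ?y = "letter_weight False y" and ?z = "letter_weight True z"
  \<comment> \<open>The flag at n is forced to be False, so \<open>Q\<close> depends only on the
    flags at 1, ..., n - 1, as standardization requires.\<close>
  define Q where "Q d = chain_sum (\<lambda>k. letter_compat (k < n \<and> d k)) {..2 * i} ?y n (2 * i + 1)" for d
  have no_last_descent: "\<not> \<pi> n > \<pi> (Suc n)" if "\<pi> permutes {1..n}" for \<pi>
    using permutes_not_in[OF that, of "Suc n"] permutes_in_image[OF that, of n] permutes_not_in[OF that, of n]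
    by (cases "n = 0") auto
  have row: "chain_sum (\<lambda>k. letter_compat (\<pi> k > \<pi> (Suc k))) {..2 * i} ?y n (2 * i + 1) =
      Q (\<lambda>k. \<pi> k > \<pi> (Suc k))" if "\<pi> permutes {1..n}" for \<pi>
    unfolding Q_def using no_last_descent[OF that]
    by (intro chain_sum_cong arg_cong[where f = "\<lambda>D. letter_compat D _ _"]) (metis le_neq_implies_less)
  have col: "chain_sum (\<lambda>k. letter_compat (inv \<pi> k > inv \<pi> (Suc k))) {..2 * j} ?z n (2 * j + 1) =
      (\<Sum>g\<in>{1..n} \<rightarrow>\<^sub>E {..2 * j}.
        if \<forall>k\<in>{1..<n}. letter_compat (inv \<pi> k > inv \<pi> (Suc k)) (g k) (g (Suc k))
        then \<Prod>k=1..n. ?z (g k) else 0)" for \<pi>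
  proof -
    have "(\<forall>k\<in>{1..n}. letter_compat (inv \<pi> k > inv \<pi> (Suc k)) (g k) (if k = n then 2 * j + 1 else g (Suc k)))
      \<longleftrightarrow> (\<forall>k\<in>{1..<n}. letter_compat (inv \<pi> k > inv \<pi> (Suc k)) (g k) (g (Suc k)))"
      if "g \<in> {1..n} \<rightarrow>\<^sub>E {..2 * j}" for g
    proof (cases "n = 0")
      case False
      then have "g n \<le> 2 * j" using PiE_mem[OF that, of n] by simp
      then have "letter_compat D (g n) (2 * j + 1)" for D by (simp add: letter_compat_def)
      then show ?thesis by (auto simp: le_less)
    qed simp
    then show ?thesis
      by (subst chain_sum_eq_sum_PiE) (auto intro!: sum.cong)
  qed
  \<comment> \<open>The sentinel exceeds every column letter, so there is no super descent at n, in
    agreement with the forced flag in \<open>Q\<close>.\<close>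
  have pair: "chain_sum (\<lambda>k. letter_compat
        (super_descent (w k) (if k = n then 2 * j + 1 else w (Suc k)))) {..2 * i} ?y n (2 * i + 1) =
      Q (\<lambda>k. super_descent (w k) (w (Suc k)))" if "w \<in> {1..n} \<rightarrow>\<^sub>E {..2 * j}" for w
    unfolding Q_def
  proof (rule chain_sum_cong)
    fix k b a assume "1 \<le> k" "k \<le> n"
    then show "letter_compat (super_descent (w k) (if k = n then 2 * j + 1 else w (Suc k))) b a =
      letter_compat (k < n \<and> super_descent (w k) (w (Suc k))) b a"
      using PiE_mem[OF that, of k] by (auto simp: super_descent_def)
  qed
  have "(\<Sum>\<pi> | \<pi> permutes {1..n}.
      chain_sum (\<lambda>k. letter_compat (\<pi> k > \<pi> (Suc k))) {..2 * i} ?y n (2 * i + 1) *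
      chain_sum (\<lambda>k. letter_compat (inv \<pi> k > inv \<pi> (Suc k))) {..2 * j} ?z n (2 * j + 1)) =
     (\<Sum>\<pi> | \<pi> permutes {1..n}. Q (\<lambda>k. \<pi> k > \<pi> (Suc k)) * (\<Sum>g\<in>{1..n} \<rightarrow>\<^sub>E {..2 * j}.
        if \<forall>k\<in>{1..<n}. letter_compat (inv \<pi> k > inv \<pi> (Suc k)) (g k) (g (Suc k))
        then \<Prod>k=1..n. ?z (g k) else 0))"
    by (intro sum.cong refl) (simp only: row col mem_Collect_eq)
  also have "\<dots> = (\<Sum>w\<in>{1..n} \<rightarrow>\<^sub>E {..2 * j}. (\<Prod>k=1..n. ?z (w k)) *
      Q (\<lambda>k. super_descent (w k) (w (Suc k))))"
    by (rule sum_over_permutations_standardize)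
       (auto simp: Q_def intro!: chain_sum_cong arg_cong[where f = "\<lambda>D. letter_compat D _ _"])
  also have "\<dots> = (\<Sum>w\<in>{1..n} \<rightarrow>\<^sub>E {..2 * j}. (\<Prod>k=1..n. ?z (w k)) *
      chain_sum (\<lambda>k. letter_compat
        (super_descent (w k) (if k = n then 2 * j + 1 else w (Suc k)))) {..2 * i} ?y n (2 * i + 1))"
    by (intro sum.cong refl) (simp only: pair)
  also have "\<dots> = biword_sum y z i j n"
    unfolding biword_sum_def pair_compat_def
    by (rule chain_sum_pairs[where R = letter_compat and S = super_descent]) simp_all
  finally show ?thesis .
qed

text \<open>As 0 and n + 1 are fixed points, neither 0 nor n is a descent. A left peak is the start
  of a maximal run of descents; declaring position 0 a descent excludes the start at 1 and leaves
  the peaks.\<close>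

lemma permutes_descent_sets:
  assumes \<pi>: "\<pi> permutes {1..n}" and "n \<ge> 1"
  shows "\<not> \<pi> 0 > \<pi> (Suc 0)" "\<not> \<pi> n > \<pi> (Suc n)"
    and "des n \<pi> = card {k \<in> {1..n}. \<pi> k > \<pi> (Suc k)}"
    and "lpk n \<pi> = card {k \<in> {1..n}. \<pi> k > \<pi> (Suc k) \<and> \<not> \<pi> (k - 1) > \<pi> (Suc (k - 1))}"
    and "pk n \<pi> = card {k \<in> {1..n}. \<pi> k > \<pi> (Suc k) \<and> \<not> (k - 1 = 0 \<or> \<pi> (k - 1) > \<pi> (Suc (k - 1)))}"
proof -
  show z: "\<not> \<pi> 0 > \<pi> (Suc 0)" using permutes_not_in[OF \<pi>, of 0] by simp
  show l: "\<not> \<pi> n > \<pi> (Suc n)"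
    using permutes_not_in[OF \<pi>, of "Suc n"] permutes_in_image[OF \<pi>, of n] assms(2) by auto
  have range: "k \<in> {1..n - 1}" if "k \<in> {1..n}" "\<pi> k > \<pi> (Suc k)" for k
    using that l by (cases "k = n") auto
  have neq: "\<pi> k \<noteq> \<pi> (Suc k)" for k
    using permutes_inj[OF \<pi>] by (metis injD n_not_Suc_n)
  have peak: "is_peak n \<pi> k \<longleftrightarrow> k \<in> {2..n - 1} \<and> \<pi> k > \<pi> (Suc k) \<and> \<not> \<pi> (k - 1) > \<pi> (Suc (k - 1))" for k
    using neq[of "k - 1"] by (auto simp: is_peak_def)
  show "des n \<pi> = card {k \<in> {1..n}. \<pi> k > \<pi> (Suc k)}"
    unfolding des_def using range by (intro arg_cong[where f = card]) force
  show "lpk n \<pi> = card {k \<in> {1..n}. \<pi> k > \<pi> (Suc k) \<and> \<not> \<pi> (k - 1) > \<pi> (Suc (k - 1))}"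
    unfolding lpk_def
  proof (intro arg_cong[where f = card] Collect_cong)
    fix k
    show "k \<in> {1..n - 1} \<and> (is_peak n \<pi> k \<or> k = 1 \<and> \<pi> 2 < \<pi> 1) \<longleftrightarrow>
      k \<in> {1..n} \<and> \<pi> k > \<pi> (Suc k) \<and> \<not> \<pi> (k - 1) > \<pi> (Suc (k - 1))"
    proof (cases "k = 1")
      case True
      then show ?thesis using z range[of 1] by (auto simp: is_peak_def numeral_2_eq_2)
    next
      case False
      then show ?thesis using range[of k] unfolding peak by auto
    qed
  qed
  show "pk n \<pi> = card {k \<in> {1..n}. \<pi> k > \<pi> (Suc k) \<and> \<not> (k - 1 = 0 \<or> \<pi> (k - 1) > \<pi> (Suc (k - 1)))}"
    unfolding pk_def peak
  proof (intro arg_cong[where f = card] Collect_cong)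
    fix k
    show "k \<in> {2..n - 1} \<and> \<pi> k > \<pi> (Suc k) \<and> \<not> \<pi> (k - 1) > \<pi> (Suc (k - 1)) \<longleftrightarrow>
      k \<in> {1..n} \<and> \<pi> k > \<pi> (Suc k) \<and> \<not> (k - 1 = 0 \<or> \<pi> (k - 1) > \<pi> (Suc (k - 1)))"
      using range[of k] by auto
  qed
qed

section \<open>Series in the four variables\<close>

lemma divide_unit_eqI:
  fixes f g d :: series
  assumes "d dvd 1" "f = g * d"
  shows "f / d = g"
proof -
  obtain c where c: "1 = d * c" using assms(1) by (elim dvdE)
  have "f / d * d = g * d" using divide_by_unit[OF assms(1), of f] assms(2) by simp
  then have "f / d * (d * c) = g * (d * c)" by (simp only: mult.assoc[symmetric])
  then show ?thesis by (simp flip: c)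
qed

lemma one_minus_fps_const: "1 - fps_const a = fps_const (1 - a :: 'a::comm_ring_1)"
  by (simp flip: fps_const_1_eq_1)

lemma fps_geometric: "Abs_fps (\<lambda>_. 1) * (1 - fps_X) = (1 :: 'a::comm_ring_1 fps)"
proof (rule fps_ext)
  fix n show "(Abs_fps (\<lambda>_. 1) * (1 - fps_X)) $ n = (1 :: 'a fps) $ n"
    by (cases n) (simp_all add: algebra_simps)
qed

text \<open>In each sum of the identity a given coefficient comes from one index at most: n on the
  left, (i, j) on the right.\<close>

lemma formal_sum_single_nth:
  assumes "\<And>k. k \<in> I \<Longrightarrow> k \<noteq> k0 \<Longrightarrow> F k $ n $ i $ j = 0"
  shows "formal_sum F I $ n $ i $ j = (if k0 \<in> I then F k0 $ n $ i $ j else 0)"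
proof -
  have "{k. k \<in> I \<and> F k $ n $ i $ j \<noteq> 0} = (if k0 \<in> I \<and> F k0 $ n $ i $ j \<noteq> 0 then {k0} else {})"
    using assms by auto
  then show ?thesis by (simp add: formal_sum_def)
qed

definition ratfun_y :: ratfun where "ratfun_y = Fract [:[:0, 1:]:] 1"
definition ratfun_z :: ratfun where "ratfun_z = Fract [:0, 1:] 1"

lemma var_y_eq: "var_y = fps_const (fps_const (fps_const ratfun_y))"
  and var_z_eq: "var_z = fps_const (fps_const (fps_const ratfun_z))"
  by (simp_all add: var_y_def var_z_def ratfun_y_def ratfun_z_def)

lemma chain_sum_fps_const:
  "fps_const (chain_sum R A v n a) = chain_sum R A (\<lambda>b. fps_const (v b)) n a"
  by (rule chain_sum_hom) simp_all

lemma letter_weight_fps_const: "fps_const (letter_weight d y c) = letter_weight d (fps_const y) c"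
  by (simp add: letter_weight_def)

lemma biword_sum_fps_const:
  "fps_const (biword_sum y z i j n) = biword_sum (fps_const y) (fps_const z) i j n"
  by (simp add: biword_sum_def chain_sum_fps_const case_prod_unfold
      flip: letter_weight_fps_const)

lemma pair_factors_eq_biword_gf:
  "((1 + var_y * var_x) / (1 - var_y * var_z * var_x)) ^ (i * j) *
   ((1 + var_z * var_x) / (1 - var_x)) ^ ((i + 1) * j) =
   Abs_fps (\<lambda>n. fps_const (fps_const (biword_sum ratfun_y ratfun_z i j n)))"
  (is "?p ^ _ * ?q ^ _ = ?g")
proof -
  note units = denominators_are_units
  let ?d = "(1 - var_y * var_z * var_x) ^ (i * j) * (1 - var_x) ^ ((i + 1) * j)"
  have power: "a ^ k dvd 1" if "a dvd 1" for a :: series and k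
    using dvd_power_same[OF that, of k] by simp
  have unit: "?d dvd 1"
    using mult_dvd_mono[OF power[OF units(9), of "i * j"] power[OF units(8), of "(i + 1) * j"]] by simp
  \<comment> \<open>\<open>biword_gf\<close> is applied over the coefficient ring
    \<open>ratfun fps fps\<close>, where y and z are constants.\<close>
  have "?g * ?d = (1 + var_y * var_x) ^ (i * j) * (1 + var_z * var_x) ^ ((i + 1) * j)"
    unfolding biword_sum_fps_const var_x_def var_y_eq var_z_eq by (rule biword_gf)
  also have "\<dots> = (?p * (1 - var_y * var_z * var_x)) ^ (i * j) * (?q * (1 - var_x)) ^ ((i + 1) * j)"
    by (simp only: divide_by_unit[OF units(9)] divide_by_unit[OF units(8)])
  also have "\<dots> = ?p ^ (i * j) * ?q ^ ((i + 1) * j) * ?d"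
    by (simp only: power_mult_distrib mult_ac)
  finally have eq: "?p ^ (i * j) * ?q ^ ((i + 1) * j) * ?d = ?g * ?d" ..
  obtain c where "1 = ?d * c" using unit by (elim dvdE)
  then show ?thesis
    using arg_cong[OF eq, of "\<lambda>u. u * c"] by (simp only: mult.assoc mult_1_right)
qed

section \<open>Generating functions of a single permutation\<close>

definition row_gf :: "nat \<Rightarrow> (nat \<Rightarrow> nat) \<Rightarrow> ratfun fps fps" where
  "row_gf n \<pi> = Abs_fps (\<lambda>i. fps_const (chain_sum (\<lambda>k. letter_compat (\<pi> k > \<pi> (Suc k)))
     {..2 * i} (letter_weight False ratfun_y) n (2 * i + 1)))"

definition col_gf :: "nat \<Rightarrow> (nat \<Rightarrow> nat) \<Rightarrow> ratfun fps" where
  "col_gf n \<sigma> = Abs_fps (\<lambda>j. chain_sum (\<lambda>k. letter_compat (\<sigma> k > \<sigma> (Suc k)))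
     {..2 * j} (letter_weight True ratfun_z) n (2 * j + 1))"

text \<open>No run of descents is open at position 0, so \<open>g = q = 1\<close> in
  \<open>transfer_closed_form\<close>, and the openings of runs are the left peaks.\<close>

lemma row_gf_closed_form:
  assumes \<pi>: "\<pi> permutes {1..n}" and n: "n \<ge> 1"
  defines "Y \<equiv> (1 + var_y)\<^sup>2 * var_s / ((var_y + var_s) * (1 + var_y * var_s))"
    and "S \<equiv> (var_y + var_s) / (1 + var_y * var_s)"
  shows "fps_const (row_gf n \<pi>) * (1 - var_s) ^ (n + 1) =
    (1 + var_y * var_s) ^ n * Y ^ lpk n \<pi> * S ^ des n \<pi>"
proof -
  let ?d = "\<lambda>k. \<pi> k > \<pi> (Suc k)"
  note sets = permutes_descent_sets[OF \<pi> n]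
  have first: "?d 0 = False" using sets(1) by blast
  have "row_gf n \<pi> * (1 - fps_X) ^ (n + 1) = transfer ?d (fps_const (fps_const ratfun_y)) fps_X n"
    unfolding row_gf_def chain_sum_fps_const letter_weight_fps_const
    using chain_sum_gf[where d = ?d, OF sets(2), of "fps_const ratfun_y"] unfolding first .
  then have gf: "fps_const (row_gf n \<pi>) * (1 - var_s) ^ (n + 1) = transfer ?d var_y var_s n"
    by (simp only: var_s_def var_y_eq one_minus_fps_const fps_const_power fps_const_mult transfer_fps_const)
  have S: "S * (1 + var_y * var_s) = var_y + var_s"
    unfolding S_def by (rule divide_by_unit) (rule denominators_are_units)
  have Y: "Y * ((var_y + var_s) * (1 + var_y * var_s)) = (1 + var_y)\<^sup>2 * var_s"
    unfolding Y_def
    using mult_dvd_mono[OF denominators_are_units(1,2)] by (intro divide_by_unit) simp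
  have "1 * transfer ?d var_y var_s n = 1 * (1 + var_y * var_s) ^ n * Y ^ lpk n \<pi> * S ^ des n \<pi>"
    using transfer_closed_form[OF S Y, of ?d 1 1 n] sets(1,2) unfolding sets(3,4) by argo
  then show ?thesis using gf by simp
qed

text \<open>The missing column letter 0 acts like a descent at position 0. The run open there
  accounts for the additional \<open>Z\<close>, \<open>T\<close> and
  \<open>1 + var_z * var_t\<close>, and its missing opening factor is the \<open>1 + var_z\<close>
  on the left.\<close>

lemma col_gf_closed_form:
  assumes \<sigma>: "\<sigma> permutes {1..n}" and n: "n \<ge> 1"
  defines "Z \<equiv> (1 + var_z)\<^sup>2 * var_t / ((var_z + var_t) * (1 + var_z * var_t))"
    and "T \<equiv> (var_z + var_t) / (1 + var_z * var_t)"
  shows "fps_const (fps_const (col_gf n \<sigma>)) * ((1 + var_z) * (1 - var_t) ^ (n + 1)) =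
    (1 + var_z * var_t) ^ (n + 1) * Z ^ (pk n \<sigma> + 1) * T ^ (des n \<sigma> + 1)"
proof -
  let ?d = "\<lambda>k. k = 0 \<or> \<sigma> k > \<sigma> (Suc k)"
  note sets = permutes_descent_sets[OF \<sigma> n]
  have first: "?d 0 = True" and last: "\<not> ?d n" using sets(2) n by auto
  \<comment> \<open>A chain sum reads the flags only at positions from 1 on, so the flag at 0 can be
    set to True.\<close>
  have "col_gf n \<sigma> = Abs_fps (\<lambda>j. chain_sum (\<lambda>k. letter_compat (?d k))
      {..2 * j} (letter_weight True ratfun_z) n (2 * j + 1))"
    unfolding col_gf_def by (intro arg_cong[where f = Abs_fps] ext chain_sum_cong) auto
  then have "col_gf n \<sigma> * (1 - fps_X) ^ (n + 1) = transfer ?d (fps_const ratfun_z) fps_X n"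
    using chain_sum_gf[where d = ?d, OF last, of ratfun_z] unfolding first by (simp only:)
  then have gf: "fps_const (fps_const (col_gf n \<sigma>)) * (1 - var_t) ^ (n + 1) = transfer ?d var_z var_t n"
    by (simp only: var_t_def var_z_eq one_minus_fps_const fps_const_power fps_const_mult transfer_fps_const)
  have T: "T * (1 + var_z * var_t) = var_z + var_t"
    unfolding T_def by (rule divide_by_unit) (rule denominators_are_units)
  have Z: "Z * ((var_z + var_t) * (1 + var_z * var_t)) = (1 + var_z)\<^sup>2 * var_t"
    unfolding Z_def
    using mult_dvd_mono[OF denominators_are_units(3,4)] by (intro divide_by_unit) simp
  let ?q = "(1 + var_z * var_t) * Z * T"
  have init: "(1 + var_z) * (var_t * (1 + var_z)) = ?q * (1 + var_z * var_t)"
  proof -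
    have "(1 + var_z) * (var_t * (1 + var_z)) = Z * ((T * (1 + var_z * var_t)) * (1 + var_z * var_t))"
      unfolding T Z by (simp add: power2_eq_square mult_ac)
    then show ?thesis by (simp only: mult_ac)
  qed
  have des: "{k \<in> {1..n}. ?d k} = {k \<in> {1..n}. \<sigma> k > \<sigma> (Suc k)}"
    and pk: "{k \<in> {1..n}. ?d k \<and> \<not> ?d (k - 1)} = {k \<in> {1..n}. \<sigma> k > \<sigma> (Suc k) \<and>
      \<not> (k - 1 = 0 \<or> \<sigma> (k - 1) > \<sigma> (Suc (k - 1)))}"
    by auto
  have "(1 + var_z) * transfer ?d var_z var_t n =
      ?q * (1 + var_z * var_t) ^ n * Z ^ pk n \<sigma> * T ^ des n \<sigma>"
    using transfer_closed_form[OF T Z, of ?d "1 + var_z" ?q n] init first last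
    unfolding des pk sets(3,5) by argo
  then show ?thesis
    unfolding gf[symmetric] power_add power_one_right by (simp only: mult_ac)
qed

text \<open>Each summand of \<open>P\<close> splits into a part in y and s that depends on
  \<open>\<pi>\<close> and a part in z and t that depends on \<open>inv \<pi>\<close>; the closed
  forms absorb the prefactors.\<close>

lemma permutation_term_eq:
  assumes n: "n \<ge> 1"
  shows "((1 + var_y * var_s) ^ n * (1 + var_z * var_t) ^ (n + 1) *
      P n ((1 + var_y)\<^sup>2 * var_s / ((var_y + var_s) * (1 + var_y * var_s)))
          ((1 + var_z)\<^sup>2 * var_t / ((var_z + var_t) * (1 + var_z * var_t)))
          ((var_y + var_s) / (1 + var_y * var_s))
          ((var_z + var_t) / (1 + var_z * var_t)))
    / ((1 + var_z) * (1 - var_s) ^ (n + 1) * (1 - var_t) ^ (n + 1)) =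
    fps_const (\<Sum>\<pi> | \<pi> permutes {1..n}. row_gf n \<pi> * fps_const (col_gf n (inv \<pi>)))"
proof (rule divide_unit_eqI)
  let ?Y = "(1 + var_y)\<^sup>2 * var_s / ((var_y + var_s) * (1 + var_y * var_s))"
  let ?Z = "(1 + var_z)\<^sup>2 * var_t / ((var_z + var_t) * (1 + var_z * var_t))"
  let ?S = "(var_y + var_s) / (1 + var_y * var_s)"
  let ?T = "(var_z + var_t) / (1 + var_z * var_t)"
  have power: "a ^ k dvd 1" if "a dvd 1" for a :: series and k
    using dvd_power_same[OF that, of k] by simp
  show "(1 + var_z) * (1 - var_s) ^ (n + 1) * (1 - var_t) ^ (n + 1) dvd 1"
    using mult_dvd_mono[OF mult_dvd_mono[OF denominators_are_units(5)
        power[OF denominators_are_units(6), of "n + 1"]] power[OF denominators_are_units(7), of "n + 1"]]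
    by simp
  have const_sum: "fps_const (sum f A) = (\<Sum>a\<in>A. fps_const (f a))"
    for f :: "(nat \<Rightarrow> nat) \<Rightarrow> ratfun fps fps" and A
    by (induction A rule: infinite_finite_induct) (simp_all flip: fps_const_add)
  have "(1 + var_y * var_s) ^ n * (1 + var_z * var_t) ^ (n + 1) * P n ?Y ?Z ?S ?T =
     (\<Sum>\<pi> | \<pi> permutes {1..n}. ((1 + var_y * var_s) ^ n * ?Y ^ lpk n \<pi> * ?S ^ des n \<pi>) *
       ((1 + var_z * var_t) ^ (n + 1) * ?Z ^ (pk n (inv \<pi>) + 1) * ?T ^ (des n (inv \<pi>) + 1)))"
    unfolding P_def ipk_def ides_def sum_distrib_left by (simp only: mult_ac)
  also have "\<dots> = (\<Sum>\<pi> | \<pi> permutes {1..n}.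
      fps_const (row_gf n \<pi>) * (1 - var_s) ^ (n + 1) *
      (fps_const (fps_const (col_gf n (inv \<pi>))) * ((1 + var_z) * (1 - var_t) ^ (n + 1))))"
    by (intro sum.cong refl)
       (simp_all only: mem_Collect_eq row_gf_closed_form[OF _ n] col_gf_closed_form[OF permutes_inv n])
  also have "\<dots> = (\<Sum>\<pi> | \<pi> permutes {1..n}. fps_const (row_gf n \<pi>) * fps_const (fps_const (col_gf n (inv \<pi>)))) *
      ((1 + var_z) * (1 - var_s) ^ (n + 1) * (1 - var_t) ^ (n + 1))"
    unfolding sum_distrib_right by (simp only: mult_ac)
  finally show "(1 + var_y * var_s) ^ n * (1 + var_z * var_t) ^ (n + 1) * P n ?Y ?Z ?S ?T =
      fps_const (\<Sum>\<pi> | \<pi> permutes {1..n}. row_gf n \<pi> * fps_const (col_gf n (inv \<pi>))) *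
      ((1 + var_z) * (1 - var_s) ^ (n + 1) * (1 - var_t) ^ (n + 1))"
    unfolding const_sum fps_const_mult .
qed

section \<open>Comparison of the coefficients of the two sides\<close>

theorem theorem4p2:
  fixes x y z s t :: series
  defines "x \<equiv> var_x" and "y \<equiv> var_y" and "z \<equiv> var_z" and "s \<equiv> var_s" and "t \<equiv> var_t"
  shows
    "1 / ((1 - s) * (1 - t)) +
     formal_sum (\<lambda>n.
       ((1 + y * s) ^ n * (1 + z * t) ^ (n + 1) *
         P n ((1 + y)\<^sup>2 * s / ((y + s) * (1 + y * s)))
             ((1 + z)\<^sup>2 * t / ((z + t) * (1 + z * t)))
             ((y + s) / (1 + y * s))
             ((z + t) / (1 + z * t)))
       / ((1 + z) * (1 - s) ^ (n + 1) * (1 - t) ^ (n + 1)) * x ^ n) {1..}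
     = formal_sum (\<lambda>(i, j).
         ((1 + y * x) / (1 - y * z * x)) ^ (i * j) *
         ((1 + z * x) / (1 - x)) ^ ((i + 1) * j) * s ^ i * t ^ j) UNIV"
  (is "?unit + formal_sum ?F {1..} = formal_sum ?G UNIV")
proof (intro fps_ext)
  fix n i j
  define c where "c n = (\<Sum>\<pi> | \<pi> permutes {1..n}. row_gf n \<pi> * fps_const (col_gf n (inv \<pi>)))" for n
  \<comment> \<open>This term supplies n = 0: every coefficient is 1, the value of
    \<open>biword_sum\<close> for the empty word.\<close>
  have unit: "?unit = fps_const (Abs_fps (\<lambda>_. 1) * fps_const (Abs_fps (\<lambda>_. 1)))"
  proof (rule divide_unit_eqI)
    show "(1 - s) * (1 - t) dvd 1"
      using mult_dvd_mono[OF denominators_are_units(6,7)] by (simp add: s_def t_def)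
    have "fps_const (Abs_fps (\<lambda>_. 1)) * (1 - s) = 1"
      by (simp only: s_def var_s_def one_minus_fps_const fps_const_mult fps_geometric fps_const_1_eq_1)
    moreover have "fps_const (fps_const (Abs_fps (\<lambda>_. 1))) * (1 - t) = 1"
      by (simp only: t_def var_t_def one_minus_fps_const fps_const_mult fps_geometric fps_const_1_eq_1)
    moreover have "(a * b) * (u * v) = (a * u) * (b * v)" for a b u v :: series
      by (simp only: mult_ac)
    ultimately show "1 = fps_const (Abs_fps (\<lambda>_. 1) * fps_const (Abs_fps (\<lambda>_. 1))) * ((1 - s) * (1 - t))"
      by (simp only: fps_const_mult[symmetric] mult_1_right)
  qed
  have F: "?F k = fps_const (c k) * fps_X ^ k" if "k \<ge> 1" for k
    unfolding x_def y_def z_def s_def t_def c_def permutation_term_eq[OF that] by (simp only: var_x_def)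
  have "formal_sum ?F {1..} $ n $ i $ j = (if n \<in> {1..} then ?F n $ n $ i $ j else 0)"
  proof (rule formal_sum_single_nth)
    fix k :: nat assume "k \<in> {1..}" "k \<noteq> n"
    then show "?F k $ n $ i $ j = 0" by (simp only: F atLeast_iff) (simp add: fps_X_power_mult_right_nth)
  qed
  also have "\<dots> = (if n \<ge> 1 then biword_sum ratfun_y ratfun_z i j n else 0)"
  proof (cases "n \<ge> 1")
    case True
    have "?F n $ n $ i $ j = c n $ i $ j"
      unfolding F[OF True] by (simp add: fps_X_power_mult_right_nth)
    \<comment> \<open>Taking the coefficient at i and j turns each product of \<open>row_gf\<close>
      and \<open>col_gf\<close> into a product of two chain sums.\<close>
    also have "\<dots> = biword_sum ratfun_y ratfun_z i j n"
      by (simp add: c_def fps_sum_nth row_gf_def col_gf_def flip: sum_permutations_chain_sum)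
    finally show ?thesis using True by simp
  qed simp
  finally have "(?unit + formal_sum ?F {1..}) $ n $ i $ j = biword_sum ratfun_y ratfun_z i j n"
    by (cases n) (simp_all add: unit biword_sum_def)
  moreover have "formal_sum ?G UNIV $ n $ i $ j = biword_sum ratfun_y ratfun_z i j n"
  proof -
    have G: "?G (k, l) $ n $ i $ j = (if k = i \<and> l = j then biword_sum ratfun_y ratfun_z k l n else 0)"
      for k l
    proof -
      have "?G (k, l) = Abs_fps (\<lambda>n. fps_const (fps_const (biword_sum ratfun_y ratfun_z k l n)))
          * fps_const (fps_X ^ k) * fps_const (fps_const (fps_X ^ l))"
        unfolding x_def y_def z_def s_def t_def prod.case pair_factors_eq_biword_gf
        by (simp only: var_s_def var_t_def fps_const_power)
      then show ?thesis
        by (auto simp: fps_X_power_mult_right_nth)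
    qed
    have "formal_sum ?G UNIV $ n $ i $ j = (if (i, j) \<in> UNIV then ?G (i, j) $ n $ i $ j else 0)"
    proof (rule formal_sum_single_nth)
      fix k :: "nat \<times> nat" assume "k \<noteq> (i, j)"
      then show "?G k $ n $ i $ j = 0" using G[of "fst k" "snd k"] by (cases k) auto
    qed
    then show ?thesis using G[of i j] by simp
  qed
  ultimately show "(?unit + formal_sum ?F {1..}) $ n $ i $ j = formal_sum ?G UNIV $ n $ i $ j"
    by simp
qed

end
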